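(* Let $S$ be a reduced information semialgebra. The following statements are equivalent. (a) $(S,+)$ satisfies the ACCP. (b) $U_n(S)$ satisfies the right ACCP for every integer $n\ge 2$. (c) $U_n(S)$ satisfies the left ACCP for every integer $n\ge 2$.
   Context: All monoids are cancellative but not necessarily commutative. An information semialgebra is a semiring $S$ with $0$ and $1$ (so $(S,+)$ is a commutative monoid with identity $0$, multiplication has identity $1$ and distributes over addition, and $0\cdot x=0$ for all $x$) such that $(S,+)$ is a cancellative commutative monoid whose only invertible element is $0$, and $(S\setminus\{0\},\cdot)$ is a cancellative commutative monoid. $S$ is reduced if $1$ is the only invertible element of $(S\setminus\{0\},\cdot)$. $U_n(S)$ is the multiplicative monoid of $n\times n$ upper triangular matrices over $S$ all of whose diagonal entries equal $1$. A monoid $M$ satisfies the left (resp. right) ACCP if every ascending chain of principal left ideals $Mx$ (resp. principal right ideals $xM$), $x\in M$, eventually stabilizes. For commutative $M$ these coincide and are called the ACCP (for $(S,+)$, principal ideals are the sets $x+S$). *)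

theory Defs
  imports "HOL-Algebra.Divisibility" "Jordan_Normal_Form.Matrix"
begin

text \<open>
  A semiring \<open>S\<close> is a type of class \<^class>\<open>semiring_1\<close>; the monoids attached to it are records
  of HOL-Algebra.
\<close>

definition additive_monoid :: "'a::comm_monoid_add monoid" where
  "additive_monoid = \<lparr>carrier = UNIV, mult = (+), one = 0\<rparr>"

definition nonzero_monoid :: "'a::semiring_1 monoid" where
  "nonzero_monoid = \<lparr>carrier = UNIV - {0}, mult = (*), one = 1\<rparr>"

definition information_semialgebra :: "'a::semiring_1 itself \<Rightarrow> bool" where
  "information_semialgebra S \<longleftrightarrow>
     comm_monoid_cancel (additive_monoid :: 'a monoid) \<and>
     Units (additive_monoid :: 'a monoid) = {0} \<and>
     comm_monoid_cancel (nonzero_monoid :: 'a monoid)"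

definition reduced_semialgebra :: "'a::semiring_1 itself \<Rightarrow> bool" where
  "reduced_semialgebra S \<longleftrightarrow> Units (nonzero_monoid :: 'a monoid) = {1}"

definition unitriangular_monoid :: "nat \<Rightarrow> 'a::semiring_1 mat monoid" where
  "unitriangular_monoid n =
     \<lparr>carrier = {A \<in> carrier_mat n n. upper_triangular A \<and> (\<forall>i<n. A $$ (i, i) = 1)},
      mult = (*), one = 1\<^sub>m n\<rparr>"

definition principal_left_ideal :: "('a, 'b) monoid_scheme \<Rightarrow> 'a \<Rightarrow> 'a set" where
  "principal_left_ideal M x = carrier M #>\<^bsub>M\<^esub> x"

definition principal_right_ideal :: "('a, 'b) monoid_scheme \<Rightarrow> 'a \<Rightarrow> 'a set" where
  "principal_right_ideal M x = x <#\<^bsub>M\<^esub> carrier M"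

definition left_accp :: "('a, 'b) monoid_scheme \<Rightarrow> bool" where
  "left_accp M \<longleftrightarrow>
     (\<forall>x :: nat \<Rightarrow> 'a.
        (\<forall>i. x i \<in> carrier M) \<and>
        (\<forall>i. principal_left_ideal M (x i) \<subseteq> principal_left_ideal M (x (Suc i))) \<longrightarrow>
        (\<exists>N. \<forall>i\<ge>N. principal_left_ideal M (x i) = principal_left_ideal M (x N)))"

definition right_accp :: "('a, 'b) monoid_scheme \<Rightarrow> bool" where
  "right_accp M \<longleftrightarrow>
     (\<forall>x :: nat \<Rightarrow> 'a.
        (\<forall>i. x i \<in> carrier M) \<and>
        (\<forall>i. principal_right_ideal M (x i) \<subseteq> principal_right_ideal M (x (Suc i))) \<longrightarrow>
        (\<exists>N. \<forall>i\<ge>N. principal_right_ideal M (x i) = principal_right_ideal M (x N)))"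

text \<open>Meant for commutative monoids only, where the left and right conditions agree
  (lemma \<open>left_accp_iff_ACCP\<close> below).\<close>

abbreviation (input) ACCP :: "('a, 'b) monoid_scheme \<Rightarrow> bool" where
  "ACCP \<equiv> right_accp"

lemma left_accp_iff_ACCP:
  assumes "comm_monoid M"
  shows "left_accp M \<longleftrightarrow> ACCP M"
proof -
  interpret comm_monoid M by fact
  have "principal_left_ideal M x = principal_right_ideal M x" if "x \<in> carrier M" for x
    using that
    by (auto simp: principal_left_ideal_def principal_right_ideal_def r_coset_def l_coset_def m_comm)
  then show ?thesis
    unfolding left_accp_def right_accp_def by (metis (mono_tags, lifting))
qed

lemma principal_right_ideal_additive_monoid:
  "principal_right_ideal additive_monoid x = range (\<lambda>s. x + s)"
  by (auto simp: principal_right_ideal_def l_coset_def additive_monoid_def)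

lemma monoid_unitriangular_monoid: "monoid (unitriangular_monoid n :: 'a::semiring_1 mat monoid)"
proof -
  have tri: "(A * B) $$ (i, j) = 0"
    if AB: "A \<in> carrier_mat n n" "B \<in> carrier_mat n n" "upper_triangular A" "upper_triangular B"
      and ij: "j < i" "i < n" for A B :: "'a mat" and i j
  proof -
    have "A $$ (i, k) * B $$ (k, j) = 0" if "k < n" for k
      using that AB ij by (cases "k < i") (simp_all add: upper_triangular_def)
    then show ?thesis
      using AB ij by (auto simp: scalar_prod_def intro!: sum.neutral)
  qed
  have diag: "(A * B) $$ (i, i) = 1"
    if AB: "A \<in> carrier_mat n n" "B \<in> carrier_mat n n" "upper_triangular A" "upper_triangular B"
      "A $$ (i, i) = 1" "B $$ (i, i) = 1" and i: "i < n" for A B :: "'a mat" and i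
  proof -
    have "A $$ (i, k) * B $$ (k, i) = (if k = i then 1 else 0)" if "k < n" for k
      using that AB i by (cases k i rule: linorder_cases) (simp_all add: upper_triangular_def)
    then have "(\<Sum>k = 0..<n. A $$ (i, k) * B $$ (k, i)) = (\<Sum>k = 0..<n. if k = i then 1 else 0)"
      by (intro sum.cong) auto
    then show ?thesis
      using AB i by (simp add: scalar_prod_def)
  qed
  show ?thesis
    by (unfold_locales) (auto simp: unitriangular_monoid_def diag intro!: upper_triangularI tri)
qed

end

theory Submission
  imports Defs
begin

text \<open>
  Since the diagonal entries are \<open>1\<close>, every entry of a product of unitriangular matrices is the
  corresponding entry of either factor plus something. So an ascending chain of principal ideals of
  \<open>U\<^sub>n(S)\<close>, on either side, yields an ascending chain of principal ideals of \<open>(S, +)\<close> in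
  each of the finitely many positions; when these chains stabilize, the generating matrices become
  constant, because \<open>0\<close> is the only invertible element of \<open>(S, +)\<close>. Conversely
  \<open>U\<^sub>2(S)\<close> is isomorphic to \<open>(S, +)\<close>.
\<close>

text \<open>Mutual divisibility gives \<open>a = b + c\<close> and \<open>b = a + d\<close>;
  cancelling \<open>a\<close> leaves \<open>d + c = 0\<close>, so \<open>d\<close> is invertible,
  hence \<open>0\<close>.\<close>

lemma principal_right_ideal_additive_monoid_antisym:
  fixes a b :: "'a::semiring_1"
  assumes S: "information_semialgebra TYPE('a)"
    and eq: "principal_right_ideal additive_monoid a = principal_right_ideal additive_monoid b"
  shows "a = b"
proof -
  interpret comm_monoid_cancel "additive_monoid :: 'a monoid"
    using S by (simp add: information_semialgebra_def)
  have range: "range (\<lambda>s. a + s) = range (\<lambda>s. b + s)"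
    using eq by (simp add: principal_right_ideal_additive_monoid)
  have "a + 0 \<in> range (\<lambda>s. b + s)" "b + 0 \<in> range (\<lambda>s. a + s)"
    using range by blast+
  then obtain c d where c: "a = b + c" and d: "b = a + d"
    by auto
  have "a + (d + c) = a + 0"
    using c d by (simp add: add.assoc)
  then have "d + c = 0"
    using l_cancel[of a "d + c" 0] by (simp add: additive_monoid_def)
  then have "d \<in> Units (additive_monoid :: 'a monoid)"
    by (auto simp: Units_def additive_monoid_def add.commute)
  then have "d = 0"
    using S by (simp add: information_semialgebra_def)
  then show ?thesis
    using d by simp
qed

text \<open>The hypothesis \<open>chain\<close> makes the ideals of the \<open>s i\<close> ascend,
  and antisymmetry turns their stabilization into equality of generators. Phrasing the result with
  \<open>eventually\<close> lets finitely many such chains be combined.\<close>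

lemma additive_chain_eventually_const:
  fixes s :: "nat \<Rightarrow> 'a::semiring_1"
  assumes S: "information_semialgebra TYPE('a)"
    and accp: "ACCP (additive_monoid :: 'a monoid)"
    and chain: "\<And>i. \<exists>t. s i = s (Suc i) + t"
  shows "eventually (\<lambda>i. s (Suc i) = s i) sequentially"
proof -
  let ?I = "\<lambda>i. principal_right_ideal additive_monoid (s i)"
  have sub: "?I i \<subseteq> ?I (Suc i)" for i
    using chain[of i] by (auto simp: principal_right_ideal_additive_monoid add.assoc)
  have "\<exists>N. \<forall>i\<ge>N. ?I i = ?I N"
    using accp sub unfolding right_accp_def by (simp add: additive_monoid_def)
  then obtain N where N: "\<And>i. i \<ge> N \<Longrightarrow> ?I i = ?I N"
    by blast
  have "s (Suc i) = s i" if "i \<ge> N" for i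
    using N[of i] N[of "Suc i"] that
    by (intro principal_right_ideal_additive_monoid_antisym[OF S]) simp
  then show ?thesis
    by (auto simp: eventually_sequentially)
qed

lemma matrix_chain_eventually_const:
  fixes x :: "nat \<Rightarrow> 'a::semiring_1 mat"
  assumes S: "information_semialgebra TYPE('a)"
    and accp: "ACCP (additive_monoid :: 'a monoid)"
    and dim: "\<And>i. x i \<in> carrier_mat m n"
    and chain: "\<And>i j k. j < m \<Longrightarrow> k < n \<Longrightarrow> \<exists>t. x i $$ (j, k) = x (Suc i) $$ (j, k) + t"
  shows "\<exists>N. \<forall>i\<ge>N. x i = x N"
proof -
  \<comment> \<open>There are only \<open>m * n\<close> positions, so one threshold serves all of
    them.\<close>
  have "eventually (\<lambda>i. \<forall>p\<in>{..<m} \<times> {..<n}. x (Suc i) $$ p = x i $$ p) sequentially"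
    by (intro eventually_ball_finite)
      (auto intro!: additive_chain_eventually_const[OF S accp] chain)
  then obtain N where N: "\<And>i j k. i \<ge> N \<Longrightarrow> j < m \<Longrightarrow> k < n \<Longrightarrow> x (Suc i) $$ (j, k) = x i $$ (j, k)"
    by (auto simp: eventually_sequentially)
  have "x i = x N" if "i \<ge> N" for i
    using that
  proof (induction rule: nat_induct_at_least)
    case (Suc i)
    have "x (Suc i) = x i"
      using N[OF Suc.hyps] dim[of i] dim[of "Suc i"] by (intro eq_matI) auto
    then show ?case
      using Suc.IH by simp
  qed simp
  then show ?thesis
    by blast
qed

text \<open>In the sum for the entry \<open>(j, k)\<close>, the summand \<open>l = k\<close> is
  \<open>A $$ (j, k) * 1\<close> and the summand \<open>l = j\<close> is
  \<open>1 * B $$ (j, k)\<close>; in each case \<open>t\<close> collects the remaining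
  summands.\<close>

lemma unitriangular_mult_entry:
  fixes A B :: "'a::semiring_1 mat"
  assumes A: "A \<in> carrier (unitriangular_monoid n)" and B: "B \<in> carrier (unitriangular_monoid n)"
    and j: "j < n" and k: "k < n"
  shows "\<exists>t. (A * B) $$ (j, k) = A $$ (j, k) + t"
    and "\<exists>t. (A * B) $$ (j, k) = B $$ (j, k) + t"
proof -
  have entry: "(A * B) $$ (j, k) = (\<Sum>l\<in>{0..<n}. A $$ (j, l) * B $$ (l, k))"
    using A B j k by (auto simp: unitriangular_monoid_def scalar_prod_def)
  have diag: "A $$ (j, j) = 1" "B $$ (k, k) = 1"
    using A B j k by (auto simp: unitriangular_monoid_def)
  show "\<exists>t. (A * B) $$ (j, k) = A $$ (j, k) + t"
    unfolding entry using k diag by (subst sum.remove[of _ k]) auto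
  show "\<exists>t. (A * B) $$ (j, k) = B $$ (j, k) + t"
    unfolding entry using j diag by (subst sum.remove[of _ j]) auto
qed

lemma right_accp_unitriangular_monoid:
  assumes S: "information_semialgebra TYPE('a::semiring_1)"
    and accp: "ACCP (additive_monoid :: 'a monoid)"
  shows "right_accp (unitriangular_monoid n :: 'a mat monoid)"
  unfolding right_accp_def
proof (intro allI impI, elim conjE)
  fix x :: "nat \<Rightarrow> 'a mat"
  let ?M = "unitriangular_monoid n :: 'a mat monoid"
  interpret monoid ?M
    by (rule monoid_unitriangular_monoid)
  assume x: "\<forall>i. x i \<in> carrier ?M"
    and sub: "\<forall>i. principal_right_ideal ?M (x i) \<subseteq> principal_right_ideal ?M (x (Suc i))"
  have "\<exists>t. x i $$ (j, k) = x (Suc i) $$ (j, k) + t" if "j < n" "k < n" for i j k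
  proof -
    have "x i \<otimes>\<^bsub>?M\<^esub> \<one>\<^bsub>?M\<^esub> \<in> principal_right_ideal ?M (x i)"
      using one_closed unfolding principal_right_ideal_def l_coset_def by blast
    then have "x i \<in> principal_right_ideal ?M (x (Suc i))"
      using x sub by auto
    then obtain B where "B \<in> carrier ?M" "x i = x (Suc i) * B"
      by (auto simp: principal_right_ideal_def l_coset_def unitriangular_monoid_def)
    then show ?thesis
      using unitriangular_mult_entry(1)[of "x (Suc i)" n B] x that by simp
  qed
  moreover have "x i \<in> carrier_mat n n" for i
    using x by (simp add: unitriangular_monoid_def)
  ultimately show "\<exists>N. \<forall>i\<ge>N. principal_right_ideal ?M (x i) = principal_right_ideal ?M (x N)"
    using matrix_chain_eventually_const[OF S accp, of x n n] by metis
qed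

lemma left_accp_unitriangular_monoid:
  assumes S: "information_semialgebra TYPE('a::semiring_1)"
    and accp: "ACCP (additive_monoid :: 'a monoid)"
  shows "left_accp (unitriangular_monoid n :: 'a mat monoid)"
  unfolding left_accp_def
proof (intro allI impI, elim conjE)
  fix x :: "nat \<Rightarrow> 'a mat"
  let ?M = "unitriangular_monoid n :: 'a mat monoid"
  interpret monoid ?M
    by (rule monoid_unitriangular_monoid)
  assume x: "\<forall>i. x i \<in> carrier ?M"
    and sub: "\<forall>i. principal_left_ideal ?M (x i) \<subseteq> principal_left_ideal ?M (x (Suc i))"
  have "\<exists>t. x i $$ (j, k) = x (Suc i) $$ (j, k) + t" if "j < n" "k < n" for i j k
  proof -
    have "\<one>\<^bsub>?M\<^esub> \<otimes>\<^bsub>?M\<^esub> x i \<in> principal_left_ideal ?M (x i)"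
      using one_closed unfolding principal_left_ideal_def r_coset_def by blast
    then have "x i \<in> principal_left_ideal ?M (x (Suc i))"
      using x sub by auto
    then obtain B where "B \<in> carrier ?M" "x i = B * x (Suc i)"
      by (auto simp: principal_left_ideal_def r_coset_def unitriangular_monoid_def)
    then show ?thesis
      using unitriangular_mult_entry(2)[of B n "x (Suc i)"] x that by simp
  qed
  moreover have "x i \<in> carrier_mat n n" for i
    using x by (simp add: unitriangular_monoid_def)
  ultimately show "\<exists>N. \<forall>i\<ge>N. principal_left_ideal ?M (x i) = principal_left_ideal ?M (x N)"
    using matrix_chain_eventually_const[OF S accp, of x n n] by metis
qed

definition unitriangular2 :: "'a::semiring_1 \<Rightarrow> 'a mat" where
  "unitriangular2 s = mat 2 2 (\<lambda>(i, j). if i = j then 1 else if i < j then s else 0)"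

lemma inj_unitriangular2: "inj (unitriangular2 :: 'a::semiring_1 \<Rightarrow> 'a mat)"
proof (rule injI)
  fix s t :: 'a
  assume "unitriangular2 s = unitriangular2 t"
  then have "unitriangular2 s $$ (0, 1) = unitriangular2 t $$ (0, 1)"
    by simp
  then show "s = t"
    by (simp add: unitriangular2_def)
qed

lemma unitriangular2_mult: "unitriangular2 s * unitriangular2 t = unitriangular2 (s + t)"
  by (rule eq_matI)
    (auto simp: unitriangular2_def scalar_prod_def numeral_2_eq_2 less_Suc_eq add.commute)

lemma carrier_unitriangular_monoid_2:
  "carrier (unitriangular_monoid 2 :: 'a::semiring_1 mat monoid) = range unitriangular2"
proof (intro equalityI subsetI)
  fix A :: "'a mat"
  assume "A \<in> carrier (unitriangular_monoid 2)"
  then have "A = unitriangular2 (A $$ (0, 1))"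
    by (intro eq_matI)
      (auto simp: unitriangular_monoid_def unitriangular2_def upper_triangular_def
        numeral_2_eq_2 less_Suc_eq)
  then show "A \<in> range unitriangular2"
    by blast
qed (auto simp: unitriangular_monoid_def unitriangular2_def upper_triangular_def)

lemma principal_ideals_unitriangular2:
  fixes s :: "'a::semiring_1"
  shows "principal_right_ideal (unitriangular_monoid 2) (unitriangular2 s) =
      unitriangular2 ` principal_right_ideal additive_monoid s"
    and "principal_left_ideal (unitriangular_monoid 2) (unitriangular2 s) =
      unitriangular2 ` principal_right_ideal additive_monoid s"
proof -
  have mult: "A \<otimes>\<^bsub>unitriangular_monoid 2\<^esub> B = A * B" for A B :: "'a mat"
    by (simp add: unitriangular_monoid_def)
  show "principal_right_ideal (unitriangular_monoid 2) (unitriangular2 s) =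
      unitriangular2 ` principal_right_ideal additive_monoid s"
    by (auto simp: principal_right_ideal_additive_monoid principal_right_ideal_def[of "unitriangular_monoid 2"]
        l_coset_def carrier_unitriangular_monoid_2 mult unitriangular2_mult)
  show "principal_left_ideal (unitriangular_monoid 2) (unitriangular2 s) =
      unitriangular2 ` principal_right_ideal additive_monoid s"
    by (auto simp: principal_right_ideal_additive_monoid principal_left_ideal_def
        r_coset_def carrier_unitriangular_monoid_2 mult unitriangular2_mult add.commute)
qed

lemma ACCP_additive_monoid_if_unitriangular:
  assumes "right_accp (unitriangular_monoid 2 :: 'a::semiring_1 mat monoid) \<or>
      left_accp (unitriangular_monoid 2 :: 'a mat monoid)"
  shows "ACCP (additive_monoid :: 'a monoid)"
  unfolding right_accp_def
proof (intro allI impI, elim conjE)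
  fix s :: "nat \<Rightarrow> 'a"
  let ?M = "unitriangular_monoid 2 :: 'a mat monoid"
  let ?I = "principal_right_ideal (additive_monoid :: 'a monoid)"
  assume sub: "\<forall>i. ?I (s i) \<subseteq> ?I (s (Suc i))"
  have carrier: "\<forall>i. unitriangular2 (s i) \<in> carrier ?M"
    by (simp add: carrier_unitriangular_monoid_2)
  have "\<exists>N. \<forall>i\<ge>N. unitriangular2 ` ?I (s i) = unitriangular2 ` ?I (s N)"
    using assms
  proof
    assume "right_accp ?M"
    from this[unfolded right_accp_def, rule_format, of "\<lambda>i. unitriangular2 (s i)"]
    show ?thesis
      using carrier sub by (simp add: principal_ideals_unitriangular2 image_mono)
  next
    assume "left_accp ?M"
    from this[unfolded left_accp_def, rule_format, of "\<lambda>i. unitriangular2 (s i)"]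
    show ?thesis
      using carrier sub by (simp add: principal_ideals_unitriangular2 image_mono)
  qed
  then show "\<exists>N. \<forall>i\<ge>N. ?I (s i) = ?I (s N)"
    by (simp add: inj_image_eq_iff[OF inj_unitriangular2])
qed

theorem theorem4p5:
  assumes "information_semialgebra TYPE('a::semiring_1)"
    and "reduced_semialgebra TYPE('a)"
  shows "(ACCP (additive_monoid :: 'a monoid) \<longleftrightarrow>
            (\<forall>n\<ge>2. right_accp (unitriangular_monoid n :: 'a mat monoid))) \<and>
         ((\<forall>n\<ge>2. right_accp (unitriangular_monoid n :: 'a mat monoid)) \<longleftrightarrow>
            (\<forall>n\<ge>2. left_accp (unitriangular_monoid n :: 'a mat monoid)))"
  using right_accp_unitriangular_monoid[OF assms(1)] left_accp_unitriangular_monoid[OF assms(1)]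
    ACCP_additive_monoid_if_unitriangular[where 'a = 'a]
  by blast

end
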